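(* Let $\mathcal{R}$ be a convex resource theory on $\mathbb{C}^d$ with set of free states $\mathcal{F}_{\mathcal{R}}$, set of free operations $\mathcal{O}_{\mathcal{R}}$ and set of free unitary operations $U_{\mathcal{R}}$. Assume that $\mathcal{R}$ includes free pure states and free unitary operations, and that any two free pure states can be connected through (transformed into one another by) a free unitary transformation. Let $\mathsf{B}_{\mathcal{R}}$ be an orthonormal basis of $\mathbb{C}^d$ whose texture-less state is a free state of $\mathcal{R}$, and for pure states $|\psi\rangle\in\mathbb{C}^d$ define the texture-based monotone $$\mathcal{M}_{\mathcal{R}}(|\psi\rangle)=\min_{U\in U_{\mathcal{R}}}\mathcal{T}_{\mathsf{B}_{\mathcal{R}}}(U|\psi\rangle).$$ Then $\mathcal{M}_{\mathcal{R}}$ is a valid pure state resource monotone within $\mathcal{R}$; that is, for every pure state $|\psi\rangle$ and every free operation $\Lambda\in\mathcal{O}_{\mathcal{R}}$ that maps pure states to pure states, $$\mathcal{M}_{\mathcal{R}}\left(\Lambda(|\psi\rangle\langle\psi|)\right)\le\mathcal{M}_{\mathcal{R}}\left(|\psi\rangle\langle\psi|\right).$$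
   Context: A resource theory $\mathcal{R}$ on $\mathbb{C}^d$ is given by a set $\mathcal{F}_{\mathcal{R}}$ of density matrices on $\mathbb{C}^d$ (free states) and a set $\mathcal{O}_{\mathcal{R}}$ of quantum operations, i.e. completely positive trace-preserving maps (free operations), such that every free operation maps every free state to a free state. It is convex if $p\rho+(1-p)\sigma\in\mathcal{F}_{\mathcal{R}}$ for all $\rho,\sigma\in\mathcal{F}_{\mathcal{R}}$ and $0\le p\le 1$. A pure state is a unit vector $|\psi\rangle$ up to phase, identified with $|\psi\rangle\langle\psi|$, so that $\mathcal{M}_{\mathcal{R}}(|\psi\rangle)$ and $\mathcal{M}_{\mathcal{R}}(|\psi\rangle\langle\psi|)$ mean the same thing; it is free if $|\psi\rangle\langle\psi|\in\mathcal{F}_{\mathcal{R}}$. $U_{\mathcal{R}}$ is the set of unitaries $U$ for which $\rho\mapsto U\rho U^\dagger$ is a free operation. For an orthonormal basis $\mathsf{B}=\{|i\rangle\}_{i=1}^d$ of $\mathbb{C}^d$, its texture-less state is $|s_1\rangle=\frac{1}{\sqrt d}\sum_{i=1}^d|i\rangle$, and the texture of a density matrix $\rho$ (in particular of a pure state $|\psi\rangle$, with $\rho=|\psi\rangle\langle\psi|$) with respect to $\mathsf{B}$ is $$\mathcal{T}_{\mathsf{B}}(\rho)=1-\frac1d\sum_{i,j=1}^d\langle i|\rho|j\rangle=1-\langle s_1|\rho|s_1\rangle .$$ A pure state resource monotone is a function on pure states that does not increase under any free operation that maps pure states to pure states. *)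

theory Defs
  imports "HOL-Analysis.Analysis"
begin

text \<open>
  The space \<open>\<complex>\<^sup>d\<close> is \<^typ>\<open>complex ^ 'n\<close> with \<open>d = CARD('n)\<close>.  The library inner product on this
  type is the real one, so the Hermitian one is introduced here; the norm it induces is the
  library norm.
\<close>

definition cinner :: "complex ^ 'n \<Rightarrow> complex ^ 'n \<Rightarrow> complex" where
  "cinner v w = (\<Sum>i\<in>UNIV. cnj (v $ i) * w $ i)"

definition adj :: "complex ^ 'n ^ 'm \<Rightarrow> complex ^ 'm ^ 'n" where
  "adj A = (\<chi> i j. cnj (A $ j $ i))"

definition cscale :: "complex \<Rightarrow> complex ^ 'n ^ 'm \<Rightarrow> complex ^ 'n ^ 'm" where
  "cscale c A = (\<chi> i j. c * A $ i $ j)"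

definition unitary :: "complex ^ 'n ^ 'n \<Rightarrow> bool" where
  "unitary U \<longleftrightarrow> adj U ** U = mat 1 \<and> U ** adj U = mat 1"

definition proj :: "complex ^ 'n \<Rightarrow> complex ^ 'n ^ 'n" where
  "proj \<psi> = (\<chi> i j. \<psi> $ i * cnj (\<psi> $ j))"

text \<open>Membership in \<open>\<real>\<^sub>\<ge>\<^sub>0\<close> says that the quadratic form is real, hence that \<open>A\<close> is Hermitian.\<close>

definition psd :: "complex ^ 'n ^ 'n \<Rightarrow> bool" where
  "psd A \<longleftrightarrow> (\<forall>v. cinner v (A *v v) \<in> \<real>\<^sub>\<ge>\<^sub>0)"

definition density :: "complex ^ 'n ^ 'n \<Rightarrow> bool" where
  "density \<rho> \<longleftrightarrow> psd \<rho> \<and> trace \<rho> = 1"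

definition pure_state :: "complex ^ 'n ^ 'n \<Rightarrow> bool" where
  "pure_state \<rho> \<longleftrightarrow> (\<exists>\<psi>. norm \<psi> = 1 \<and> \<rho> = proj \<psi>)"

text \<open>
  An operator on \<open>\<complex>\<^sup>k \<otimes> \<complex>\<^sup>d\<close> is given by its blocks \<open>X i j\<close> for \<open>i, j < k\<close>, that is
  \<open>X = \<Sum>i j. |i\<rangle>\<langle>j| \<otimes> X i j\<close>, and a vector by its components \<open>v i\<close> for \<open>i < k\<close>.  In this
  representation \<open>id\<^sub>k \<otimes> \<Lambda>\<close> applies \<open>\<Lambda>\<close> to every block.
\<close>

definition block_psd :: "nat \<Rightarrow> (nat \<Rightarrow> nat \<Rightarrow> complex ^ 'n ^ 'n) \<Rightarrow> bool" where
  "block_psd k X \<longleftrightarrow>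
     (\<forall>v :: nat \<Rightarrow> complex ^ 'n. (\<Sum>i<k. \<Sum>j<k. cinner (v i) (X i j *v v j)) \<in> \<real>\<^sub>\<ge>\<^sub>0)"

definition completely_positive :: "(complex ^ 'n ^ 'n \<Rightarrow> complex ^ 'n ^ 'n) \<Rightarrow> bool" where
  "completely_positive \<Lambda> \<longleftrightarrow>
     (\<forall>k X. block_psd k X \<longrightarrow> block_psd k (\<lambda>i j. \<Lambda> (X i j)))"

definition quantum_operation :: "(complex ^ 'n ^ 'n \<Rightarrow> complex ^ 'n ^ 'n) \<Rightarrow> bool" where
  "quantum_operation \<Lambda> \<longleftrightarrow>
     (\<forall>A B. \<Lambda> (A + B) = \<Lambda> A + \<Lambda> B) \<and> (\<forall>c A. \<Lambda> (cscale c A) = cscale c (\<Lambda> A)) \<and>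
     completely_positive \<Lambda> \<and> (\<forall>A. trace (\<Lambda> A) = trace A)"

definition resource_theory ::
  "(complex ^ 'n ^ 'n) set \<Rightarrow> (complex ^ 'n ^ 'n \<Rightarrow> complex ^ 'n ^ 'n) set \<Rightarrow> bool" where
  "resource_theory F Ops \<longleftrightarrow>
     (\<forall>\<rho>\<in>F. density \<rho>) \<and> (\<forall>\<Lambda>\<in>Ops. quantum_operation \<Lambda>) \<and> (\<forall>\<Lambda>\<in>Ops. \<forall>\<rho>\<in>F. \<Lambda> \<rho> \<in> F)"

definition unitary_channel :: "complex ^ 'n ^ 'n \<Rightarrow> complex ^ 'n ^ 'n \<Rightarrow> complex ^ 'n ^ 'n" where
  "unitary_channel U \<rho> = U ** \<rho> ** adj U"

definition free_unitaries ::
  "(complex ^ 'n ^ 'n \<Rightarrow> complex ^ 'n ^ 'n) set \<Rightarrow> (complex ^ 'n ^ 'n) set" where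
  "free_unitaries Ops = {U. unitary U \<and> unitary_channel U \<in> Ops}"

definition orthonormal_basis :: "('n \<Rightarrow> complex ^ 'n) \<Rightarrow> bool" where
  "orthonormal_basis B \<longleftrightarrow>
     (\<forall>i j. cinner (B i) (B j) = (if i = j then 1 else 0)) \<and> vec.span (range B) = UNIV"

definition textureless :: "('n \<Rightarrow> complex ^ 'n) \<Rightarrow> complex ^ 'n" where
  "textureless B = (1 / sqrt (real CARD('n))) *\<^sub>R (\<Sum>i\<in>UNIV. B i)"

text \<open>The double sum is real whenever \<open>\<rho>\<close> is Hermitian; \<open>Re\<close> only adjusts the type.\<close>

definition texture :: "('n \<Rightarrow> complex ^ 'n) \<Rightarrow> complex ^ 'n ^ 'n \<Rightarrow> real" where
  "texture B \<rho> = 1 - Re (\<Sum>i\<in>UNIV. \<Sum>j\<in>UNIV. cinner (B i) (\<rho> *v B j)) / real CARD('n)"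

text \<open>
  A pure state \<open>|\<psi>\<rangle>\<close> is represented by \<open>proj \<psi>\<close>, and \<open>U|\<psi>\<rangle>\<close> by \<open>unitary_channel U (proj \<psi>)\<close>
  (see \<open>unitary_channel_proj\<close> below).  The minimum over the free unitaries is written as an
  infimum, since it need not be attained if the set of free unitaries is not closed; it is the
  minimum whenever that exists (see \<open>texture_monotone_eq_minimum\<close>).
\<close>

definition texture_monotone ::
  "(complex ^ 'n ^ 'n \<Rightarrow> complex ^ 'n ^ 'n) set \<Rightarrow> ('n \<Rightarrow> complex ^ 'n) \<Rightarrow> complex ^ 'n ^ 'n \<Rightarrow> real"
  where
  "texture_monotone Ops B \<rho> = (INF U\<in>free_unitaries Ops. texture B (unitary_channel U \<rho>))"

text \<open>Only the values of \<open>f\<close> on pure states matter.\<close>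

definition pure_state_monotone ::
  "(complex ^ 'n ^ 'n \<Rightarrow> complex ^ 'n ^ 'n) set \<Rightarrow> (complex ^ 'n ^ 'n \<Rightarrow> real) \<Rightarrow> bool" where
  "pure_state_monotone Ops f \<longleftrightarrow>
     (\<forall>\<Lambda>\<in>Ops. (\<forall>\<rho>. pure_state \<rho> \<longrightarrow> pure_state (\<Lambda> \<rho>)) \<longrightarrow>
        (\<forall>\<psi>. norm \<psi> = 1 \<longrightarrow> f (\<Lambda> (proj \<psi>)) \<le> f (proj \<psi>)))"

lemma unitary_channel_proj: "unitary_channel U (proj \<psi>) = proj (U *v \<psi>)"
  by (simp add: unitary_channel_def proj_def adj_def matrix_matrix_mult_def
      matrix_vector_mult_def vec_eq_iff sum_distrib_left sum_distrib_right mult_ac)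

lemma texture_monotone_eq_minimum:
  assumes "U \<in> free_unitaries Ops"
    and "\<And>V. V \<in> free_unitaries Ops \<Longrightarrow>
      texture B (unitary_channel U \<rho>) \<le> texture B (unitary_channel V \<rho>)"
  shows "texture_monotone Ops B \<rho> = texture B (unitary_channel U \<rho>)"
  unfolding texture_monotone_def using assms by (intro cInf_eq_minimum) auto

lemma texture_eq: "texture B \<rho> = 1 - Re (cinner (textureless B) (\<rho> *v textureless B))"
proof -
  have add: "cinner (sum f S) w = (\<Sum>i\<in>S. cinner (f i) w)"
    "cinner w (sum f S) = (\<Sum>i\<in>S. cinner w (f i))" for f :: "'a \<Rightarrow> complex ^ 'a" and S w
    by (simp_all add: cinner_def sum_distrib_left sum_distrib_right)
      (rule sum.swap)+
  have scale: "cinner (r *\<^sub>R v) (\<rho> *v (r *\<^sub>R w)) = (r * r) *\<^sub>R cinner v (\<rho> *v w)"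
    for r and v w :: "complex ^ 'a"
    unfolding cinner_def matrix_vector_mult_def
    by (simp add: sum_distrib_left scaleR_sum_right mult_ac)
  have mv: "\<rho> *v (\<Sum>j\<in>UNIV. B j) = (\<Sum>j\<in>UNIV. \<rho> *v B j)"
    by (rule vec.linear_sum[OF matrix_vector_mul_linear_gen])
  show ?thesis
    by (simp add: texture_def textureless_def scale mv add flip: real_sqrt_mult)
      (rule sum.swap)
qed

end

theory Submission
  imports Defs
begin

text \<open>
  For pure states, the real inner product of matrices is the fidelity, and the texture of \<open>\<rho>\<close> is
  \<open>1 - |s\<rangle>\<langle>s| \<bullet> \<rho>\<close> with \<open>s\<close> the texture-less state.  A difference of two pure states is
  \<open>t (P - Q)\<close> with \<open>P, Q\<close> pure and \<open>t\<^sup>2\<close> one minus their fidelity; hence a linear map that preserves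
  pure states does not decrease the fidelity.  A free unitary \<open>U\<close> need not have a free inverse,
  but by compactness \<open>U\<^sup>-\<^sup>1|s\<rangle>\<close> is a limit of the free states \<open>U\<^sup>k|s\<rangle>\<close>.  So the fidelity of \<open>U|\<psi>\<rangle>\<close>
  with \<open>|s\<rangle>\<close> is approximated by that of \<open>|\<psi>\<rangle>\<close> with a free pure state, which \<open>\<Lambda>\<close> does not decrease,
  and a free unitary carries the image of that free state back to \<open>|s\<rangle>\<close>.
\<close>

section \<open>Pure states in the real inner product of matrices\<close>

lemma inner_complex_Re: "x \<bullet> y = Re (cnj x * y)"
  by (simp add: inner_complex_def)

lemma inner_vec_cinner: "v \<bullet> w = Re (cinner v w)"
  by (simp add: inner_vec_def cinner_def inner_complex_Re)

lemma cinner_self: "cinner v v = of_real ((norm v)\<^sup>2)"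
proof -
  have "Im (cinner v v) = 0"
    by (simp add: cinner_def mult.commute)
  then show ?thesis
    by (simp add: complex_eq_iff power2_norm_eq_inner inner_vec_cinner)
qed

lemma inner_proj_proj: "proj a \<bullet> proj b = (cmod (cinner a b))\<^sup>2"
proof -
  have "cinner a b * cnj (cinner a b) =
      (\<Sum>i\<in>UNIV. \<Sum>j\<in>UNIV. cnj (a $ i * cnj (a $ j)) * (b $ i * cnj (b $ j)))"
    unfolding cinner_def cnj_sum sum_product by (simp add: mult_ac)
  then have "Re (cinner a b * cnj (cinner a b)) = proj a \<bullet> proj b"
    by (simp only: inner_vec_def proj_def inner_complex_Re vec_lambda_beta Re_sum)
  then show ?thesis
    by (simp only: complex_norm_square[symmetric] Re_complex_of_real)
qed

lemma norm_proj: "norm (proj a) = (norm a)\<^sup>2"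
proof -
  have "(norm (proj a))\<^sup>2 = ((norm a)\<^sup>2)\<^sup>2"
    by (simp only: power2_norm_eq_inner[of "proj a"] inner_proj_proj cinner_self)
      (simp add: norm_power)
  then show ?thesis
    by (rule power2_eq_imp_eq) simp_all
qed

lemma trace_proj: "trace (proj a) = of_real ((norm a)\<^sup>2)"
  unfolding cinner_self[symmetric] by (simp add: trace_def proj_def cinner_def mult.commute)

lemma pure_state_iff_norm: "pure_state (proj a) \<longleftrightarrow> norm a = 1"
proof
  assume "pure_state (proj a)"
  then obtain b where "norm b = 1" "proj a = proj b"
    by (auto simp: pure_state_def)
  then have "(norm a)\<^sup>2 = 1"
    by (metis norm_proj one_power2)
  then show "norm a = 1"
    by (simp add: power2_eq_1_iff) (smt (verit) norm_ge_zero)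
qed (auto simp: pure_state_def)

lemma norm_pure_state: "pure_state \<rho> \<Longrightarrow> norm \<rho> = 1"
  by (auto simp: pure_state_def norm_proj)

lemma inner_pure_state_nonneg: "pure_state \<rho> \<Longrightarrow> pure_state \<sigma> \<Longrightarrow> 0 \<le> \<rho> \<bullet> \<sigma>"
  by (auto simp: pure_state_def inner_proj_proj)

lemma proj_phase: "cmod \<omega> = 1 \<Longrightarrow> proj (\<omega> *s b) = proj b"
proof -
  assume "cmod \<omega> = 1"
  then have "\<omega> * cnj \<omega> = 1"
    by (simp add: complex_norm_square[symmetric])
  then have "\<omega> * x * (cnj \<omega> * y) = x * y" for x y
    by (metis mult.assoc mult.left_commute mult_1)
  then show ?thesis
    by (simp add: proj_def vec_eq_iff)
qed

lemma proj_scaleR: "proj (r *\<^sub>R a) = r\<^sup>2 *\<^sub>R proj a"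
  by (simp add: proj_def vec_eq_iff power2_eq_square)

section \<open>Fidelity of pure states under linear maps\<close>

text \<open>A pure state fixes its vector only up to a phase. Choosing the phase that makes the
  Hermitian overlap with \<open>a\<close> real and nonnegative lets real inner products of vectors
  do the remaining work.\<close>

lemma pure_state_aligned:
  assumes "pure_state \<sigma>"
  obtains b where "norm b = 1" "\<sigma> = proj b" "a \<bullet> b \<ge> 0" "(a \<bullet> b)\<^sup>2 = proj a \<bullet> \<sigma>"
proof -
  obtain b where b: "norm b = 1" "\<sigma> = proj b"
    using assms by (auto simp: pure_state_def)
  \<comment> \<open>\<open>\<omega>\<close> cancels the phase of the overlap. At overlap 0 any phase
    will do, but \<open>sgn 0 = 0\<close> is not one, hence the separate value 1.\<close>
  define \<omega> where "\<omega> = (if cinner a b = 0 then 1 else cnj (sgn (cinner a b)))"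
  have \<omega>: "cmod \<omega> = 1"
    by (simp add: \<omega>_def norm_sgn)
  have "cinner a (\<omega> *s b) = \<omega> * cinner a b"
    by (simp add: cinner_def sum_distrib_left mult_ac)
  also have "\<dots> = of_real (cmod (cinner a b))"
  proof (cases "cinner a b = 0")
    case False
    then have "of_real ((cmod (cinner a b))\<^sup>2) / of_real (cmod (cinner a b))
        = complex_of_real (cmod (cinner a b))"
      by (simp add: power2_eq_square)
    then show ?thesis
      using False unfolding complex_norm_square by (simp add: \<omega>_def sgn_eq mult.commute)
  qed (simp add: \<omega>_def)
  finally have "a \<bullet> (\<omega> *s b) = cmod (cinner a b)"
    by (simp add: inner_vec_cinner)
  moreover have "norm (\<omega> *s b) = 1"
    using proj_phase[OF \<omega>, of b] b pure_state_iff_norm by metis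
  ultimately show ?thesis
    using that[of "\<omega> *s b"] b proj_phase[OF \<omega>, of b] by (simp add: inner_proj_proj)
qed

text \<open>This is the spectral decomposition of a traceless Hermitian matrix of rank at most two:
  its nonzero eigenvalues are opposite, and \<open>P\<close>, \<open>Q\<close> project onto their
  eigenvectors.\<close>

lemma pure_state_diff:
  assumes "pure_state \<rho>" "pure_state \<sigma>"
  obtains P Q where "pure_state P" "pure_state Q" "\<rho> - \<sigma> = sqrt (1 - \<rho> \<bullet> \<sigma>) *\<^sub>R (P - Q)"
proof -
  obtain a where a: "norm a = 1" "\<rho> = proj a"
    using assms by (auto simp: pure_state_def)
  obtain b where b: "norm b = 1" "\<sigma> = proj b" "a \<bullet> b \<ge> 0" "(a \<bullet> b)\<^sup>2 = proj a \<bullet> \<sigma>"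
    using pure_state_aligned[OF assms(2)] .
  define c where "c = a \<bullet> b"
  have aa: "a \<bullet> a = 1" and bb: "b \<bullet> b = 1"
    using a b by (simp_all add: norm_eq_1)
  have c: "0 \<le> c" "c \<le> 1" "c\<^sup>2 = \<rho> \<bullet> \<sigma>"
    using a b norm_cauchy_schwarz[of a b] by (simp_all add: c_def)
  show ?thesis
  proof (cases "c = 1")
    \<comment> \<open>The two states coincide, so the coefficient is 0 and any pure
      \<open>P\<close>, \<open>Q\<close> serve. The construction below would break down, as
      \<open>s\<close> would be 0.\<close>
    case True
    then have "(a - b) \<bullet> (a - b) = 0"
      using aa bb by (simp add: c_def inner_diff inner_commute)
    then have "\<rho> = \<sigma>"
      using a b by simp
    then show ?thesis
      using that[OF assms] c(3) True by simp
  next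
    case False
    define r where "r = sqrt (2 + 2 * c)"
    define s where "s = sqrt (2 - 2 * c)"
    have pos: "r > 0" "s > 0" and r2: "r\<^sup>2 = 2 + 2 * c" and s2: "s\<^sup>2 = 2 - 2 * c"
      using c False by (simp_all add: r_def s_def)
    \<comment> \<open>\<open>a + b\<close> and \<open>a - b\<close> are orthogonal with norms
      \<open>r\<close> and \<open>s\<close>. The crossed weights give them equal length, so their
      sum and difference are the two eigenvectors, up to normalisation.\<close>
    define u where "u = s *\<^sub>R (a + b) + r *\<^sub>R (a - b)"
    define w where "w = s *\<^sub>R (a + b) - r *\<^sub>R (a - b)"
    define N where "N = 2 * r\<^sup>2 * s\<^sup>2"
    have ip: "(a + b) \<bullet> (a + b) = r\<^sup>2" "(a - b) \<bullet> (a - b) = s\<^sup>2" "(a + b) \<bullet> (a - b) = 0"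
      unfolding r2 s2 using aa bb
      by (simp_all add: c_def inner_diff inner_add inner_commute)
    have orth: "(s *\<^sub>R x + r *\<^sub>R y) \<bullet> (s *\<^sub>R x + r *\<^sub>R y) = s\<^sup>2 * (x \<bullet> x) + r\<^sup>2 * (y \<bullet> y)"
      "(s *\<^sub>R x - r *\<^sub>R y) \<bullet> (s *\<^sub>R x - r *\<^sub>R y) = s\<^sup>2 * (x \<bullet> x) + r\<^sup>2 * (y \<bullet> y)"
      if "x \<bullet> y = 0" for x y :: "complex ^ 'a"
      using that by (simp_all add: inner_add inner_diff inner_commute power2_eq_square)
    have N: "u \<bullet> u = N" "w \<bullet> w = N"
      unfolding u_def w_def N_def using orth[OF ip(3)] by (simp_all add: ip mult.commute)
    have Npos: "N > 0"
      using pos by (simp add: N_def)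
    define P where "P = proj ((1 / sqrt N) *\<^sub>R u)"
    define Q where "Q = proj ((1 / sqrt N) *\<^sub>R w)"
    have "norm u = sqrt N" "norm w = sqrt N"
      using N by (simp_all add: norm_eq_sqrt_inner)
    then have pure: "pure_state P" "pure_state Q"
      using Npos by (simp_all add: P_def Q_def pure_state_iff_norm)
    have "proj u - proj w = (4 * r * s) *\<^sub>R (\<rho> - \<sigma>)"
      by (simp add: a b u_def w_def proj_def vec_eq_iff scaleR_conv_of_real[where 'a = complex] algebra_simps)
    then have "N *\<^sub>R (P - Q) = (4 * r * s) *\<^sub>R (\<rho> - \<sigma>)"
      using Npos by (simp add: P_def Q_def proj_scaleR power_divide scaleR_diff_right)
    then have "(1 / (4 * r * s)) *\<^sub>R (N *\<^sub>R (P - Q)) = \<rho> - \<sigma>"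
      using pos by simp
    moreover have "N / (4 * r * s) = r * s / 2"
      using pos by (simp add: N_def power2_eq_square field_simps)
    ultimately have "\<rho> - \<sigma> = (r * s / 2) *\<^sub>R (P - Q)"
      by simp
    moreover have "(r * s / 2)\<^sup>2 = 1 - c\<^sup>2"
      by (simp add: power_mult_distrib power_divide r2 s2) (simp add: power2_eq_square algebra_simps)
    then have "r * s / 2 = sqrt (1 - \<rho> \<bullet> \<sigma>)"
      using pos c(3) by (intro real_sqrt_unique[symmetric]) auto
    ultimately show ?thesis
      using that[OF pure] by simp
  qed
qed

text \<open>Between pure states the squared distance is 2 minus twice the fidelity. Applying
  \<open>L\<close> to the decomposition of \<open>\<rho> - \<sigma>\<close> keeps the coefficient,
  and the images of \<open>P\<close> and \<open>Q\<close>, having nonnegative fidelity, are at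
  squared distance at most 2.\<close>

lemma pure_preserving_inner_mono:
  assumes "linear L" and pure: "\<And>\<rho>. pure_state \<rho> \<Longrightarrow> pure_state (L \<rho>)"
    and \<rho>: "pure_state \<rho>" and \<sigma>: "pure_state \<sigma>"
  shows "\<rho> \<bullet> \<sigma> \<le> L \<rho> \<bullet> L \<sigma>"
proof -
  have sq: "(norm (A - C))\<^sup>2 = 2 - 2 * (A \<bullet> C)" if "pure_state A" "pure_state C"
    for A C :: "complex ^ 'b ^ 'b"
    using norm_pure_state[OF that(1)] norm_pure_state[OF that(2)]
    by (simp add: power2_norm_eq_inner norm_eq_1 inner_diff inner_commute)
  obtain P Q where PQ: "pure_state P" "pure_state Q"
    and eq: "\<rho> - \<sigma> = sqrt (1 - \<rho> \<bullet> \<sigma>) *\<^sub>R (P - Q)"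
    using pure_state_diff[OF \<rho> \<sigma>] .
  have le1: "\<rho> \<bullet> \<sigma> \<le> 1"
    using norm_cauchy_schwarz[of \<rho> \<sigma>] norm_pure_state[OF \<rho>] norm_pure_state[OF \<sigma>] by simp
  have "L \<rho> - L \<sigma> = sqrt (1 - \<rho> \<bullet> \<sigma>) *\<^sub>R (L P - L Q)"
    using arg_cong[OF eq, of L] assms(1) by (simp add: linear_diff linear_scale)
  then have "(norm (L \<rho> - L \<sigma>))\<^sup>2 = (1 - \<rho> \<bullet> \<sigma>) * (norm (L P - L Q))\<^sup>2"
    using le1 by (simp add: power_mult_distrib)
  then have "2 - 2 * (L \<rho> \<bullet> L \<sigma>) = (1 - \<rho> \<bullet> \<sigma>) * (2 - 2 * (L P \<bullet> L Q))"
    using pure PQ \<rho> \<sigma> by (simp add: sq)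
  also have "\<dots> \<le> (1 - \<rho> \<bullet> \<sigma>) * 2"
    using le1 inner_pure_state_nonneg[OF pure pure, OF PQ] by (intro mult_left_mono) auto
  finally show ?thesis
    by simp
qed

lemma quantum_operation_linear: "quantum_operation \<Lambda> \<Longrightarrow> linear \<Lambda>"
proof (rule linearI)
  fix r :: real and A
  assume "quantum_operation \<Lambda>"
  moreover have "r *\<^sub>R A = cscale (of_real r) A" for A :: "complex ^ 'a ^ 'a"
    by (simp add: cscale_def vec_eq_iff scaleR_conv_of_real[where 'a = complex])
  ultimately show "\<Lambda> (r *\<^sub>R A) = r *\<^sub>R \<Lambda> A"
    by (simp add: quantum_operation_def)
qed (simp add: quantum_operation_def)

section \<open>Unitary channels as isometries, and recurrence\<close>

text \<open>In this form, cyclicity of the trace yields unitary invariance.\<close>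

lemma inner_matrix_trace: "A \<bullet> C = Re (trace (adj A ** C))"
  unfolding inner_vec_def trace_def adj_def matrix_matrix_mult_def
  by (subst sum.swap) (simp add: inner_complex_Re)

lemma adj_mult: "adj (A ** C) = adj C ** adj A"
  by (simp add: adj_def matrix_matrix_mult_def vec_eq_iff mult.commute)

lemma adj_adj: "adj (adj A) = A"
  by (simp add: adj_def vec_eq_iff)

lemma inner_unitary_channel:
  assumes "unitary U"
  shows "unitary_channel U A \<bullet> unitary_channel U C = A \<bullet> C"
proof -
  have U: "adj U ** U = mat 1"
    using assms by (simp add: unitary_def)
  have "adj (unitary_channel U A) ** unitary_channel U C
      = U ** adj A ** ((adj U ** U) ** (C ** adj U))"
    by (simp only: unitary_channel_def adj_mult adj_adj matrix_mul_assoc)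
  also have "\<dots> = U ** (adj A ** C ** adj U)"
    by (simp only: U matrix_mul_lid) (simp only: matrix_mul_assoc)
  finally have "trace (adj (unitary_channel U A) ** unitary_channel U C)
      = trace ((adj A ** C ** adj U) ** U)"
    by (simp only: trace_mul_sym[of U])
  also have "(adj A ** C ** adj U) ** U = adj A ** C"
    by (simp add: U matrix_mul_assoc[symmetric])
  finally show ?thesis
    by (simp add: inner_matrix_trace)
qed

lemma unitary_channel_diff:
  "unitary_channel U (A - C) = unitary_channel U A - unitary_channel U C"
  by (simp add: unitary_channel_def matrix_matrix_mult_def vec_eq_iff algebra_simps sum_subtractf)

lemma dist_unitary_channel:
  assumes "unitary U"
  shows "dist (unitary_channel U A) (unitary_channel U C) = dist A C"
  by (simp add: dist_norm norm_eq_sqrt_inner unitary_channel_diff[symmetric]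
      inner_unitary_channel[OF assms])

lemma pure_state_unitary_channel:
  assumes "unitary U" "pure_state \<rho>"
  shows "pure_state (unitary_channel U \<rho>)"
proof -
  obtain a where a: "\<rho> = proj a" "norm (proj a) = 1"
    using assms(2) norm_pure_state by (auto simp: pure_state_def)
  have "norm (proj (U *v a)) = 1"
    using a(2) inner_unitary_channel[OF assms(1), of "proj a" "proj a"]
    by (simp add: unitary_channel_proj norm_eq_1)
  then have "norm (U *v a) = 1"
    by (simp add: norm_proj power2_eq_1_iff) (smt (verit) norm_ge_zero)
  then show ?thesis
    by (simp add: a unitary_channel_proj pure_state_iff_norm)
qed

text \<open>By compactness two iterates of \<open>x\<close> with different exponents come close, and
  an isometry allows the smaller exponent to be cancelled. The exponent left is positive, so one
  application of \<open>f\<close> can be split off.\<close>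

lemma isometry_recurrence:
  fixes f :: "'a::metric_space \<Rightarrow> 'a"
  assumes "compact S" "\<And>k. (f ^^ k) x \<in> S" "\<And>y z. dist (f y) (f z) = dist y z" "e > 0"
  obtains k where "dist ((f ^^ Suc k) x) x < e"
proof -
  have iso: "dist ((f ^^ n) y) ((f ^^ n) z) = dist y z" for n y z
    by (induction n) (simp_all add: assms(3))
  obtain l r where r: "strict_mono r" "((\<lambda>n. (f ^^ n) x) \<circ> r) \<longlonglongrightarrow> l"
    using assms(1,2) unfolding compact_def by metis
  then have "Cauchy ((\<lambda>n. (f ^^ n) x) \<circ> r)"
    using LIMSEQ_imp_Cauchy by blast
  then obtain M where "\<And>m n. m \<ge> M \<Longrightarrow> n \<ge> M \<Longrightarrow> dist ((f ^^ r m) x) ((f ^^ r n) x) < e"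
    using assms(4) unfolding Cauchy_def comp_def by blast
  then have *: "dist ((f ^^ r (Suc M)) x) ((f ^^ r M) x) < e"
    by simp
  have "r M < r (Suc M)"
    using r(1) by (simp add: strict_mono_Suc_iff)
  then obtain k where "r (Suc M) = r M + Suc k"
    using less_imp_Suc_add by fastforce
  then have "dist ((f ^^ Suc k) x) x < e"
    using * by (simp only: funpow_add comp_def iso)
  then show ?thesis
    using that by blast
qed

section \<open>Texture as fidelity, and the monotone\<close>

lemma texture_inner: "texture B \<rho> = 1 - proj (textureless B) \<bullet> \<rho>"
proof -
  have "Re (cinner s (\<rho> *v s)) = proj s \<bullet> \<rho>" for s
    unfolding cinner_def matrix_vector_mult_def inner_vec_def proj_def inner_complex_Re
    by (simp only: vec_lambda_beta sum_distrib_left Re_sum complex_cnj_mult complex_cnj_cnj mult_ac)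
  then show ?thesis
    by (simp add: texture_eq)
qed

theorem theorem3:
  fixes F :: "(complex ^ 'n ^ 'n) set"
    and Ops :: "(complex ^ 'n ^ 'n \<Rightarrow> complex ^ 'n ^ 'n) set"
    and B :: "'n \<Rightarrow> complex ^ 'n"
  assumes "resource_theory F Ops"
    and "convex F"
    and "\<exists>\<rho>\<in>F. pure_state \<rho>"
    and "free_unitaries Ops \<noteq> {}"
    and "\<And>\<rho> \<sigma>. \<rho> \<in> F \<Longrightarrow> pure_state \<rho> \<Longrightarrow> \<sigma> \<in> F \<Longrightarrow> pure_state \<sigma> \<Longrightarrow>
           \<exists>U\<in>free_unitaries Ops. unitary_channel U \<rho> = \<sigma>"
    and "orthonormal_basis B"
    and "proj (textureless B) \<in> F"
  shows "pure_state_monotone Ops (texture_monotone Ops B)"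
  unfolding pure_state_monotone_def
proof (intro ballI impI allI)
  fix \<Lambda> and \<psi> :: "complex ^ 'n"
  assume \<Lambda>: "\<Lambda> \<in> Ops" and pure: "\<forall>\<rho>. pure_state \<rho> \<longrightarrow> pure_state (\<Lambda> \<rho>)" and "norm \<psi> = 1"
  define \<rho> where "\<rho> = proj \<psi>"
  define \<sigma> where "\<sigma> = proj (textureless B)"
  have \<rho>: "pure_state \<rho>" "norm \<rho> = 1"
    using \<open>norm \<psi> = 1\<close> by (auto simp: \<rho>_def pure_state_iff_norm norm_proj)
  \<comment> \<open>The texture-less vector gets its unit norm from \<open>\<sigma>\<close> being
    free, hence a density matrix.\<close>
  have "trace \<sigma> = 1"
    using assms(1,7) by (auto simp: resource_theory_def density_def \<sigma>_def)
  then have "(norm (textureless B))\<^sup>2 = 1"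
    by (metis \<sigma>_def trace_proj of_real_eq_1_iff)
  then have \<sigma>: "pure_state \<sigma>" "norm \<sigma> = 1" "\<sigma> \<in> F"
    using assms(7) by (auto simp: \<sigma>_def pure_state_iff_norm norm_proj power2_eq_1_iff)
      (smt (verit) norm_ge_zero)
  have free: "\<tau> \<in> F \<Longrightarrow> \<Phi> \<in> Ops \<Longrightarrow> \<Phi> \<tau> \<in> F" for \<tau> \<Phi>
    using assms(1) by (auto simp: resource_theory_def)
  have lin: "linear \<Lambda>"
    using assms(1) \<Lambda> by (auto simp: resource_theory_def intro: quantum_operation_linear)
  \<comment> \<open>A real infimum lies below its members only for sets bounded below; here
    Cauchy-Schwarz supplies the bound 0.\<close>
  have bdd: "bdd_below ((\<lambda>U. texture B (unitary_channel U (\<Lambda> \<rho>))) ` free_unitaries Ops)"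
  proof (rule bdd_belowI2)
    fix U
    assume "U \<in> free_unitaries Ops"
    then have "norm (unitary_channel U (\<Lambda> \<rho>)) = 1"
      using \<rho> pure by (auto simp: free_unitaries_def
          intro!: norm_pure_state pure_state_unitary_channel)
    then show "0 \<le> texture B (unitary_channel U (\<Lambda> \<rho>))"
      using norm_cauchy_schwarz[of \<sigma> "unitary_channel U (\<Lambda> \<rho>)"] \<sigma>
      by (simp add: texture_inner \<sigma>_def)
  qed
  have "texture_monotone Ops B (\<Lambda> \<rho>) \<le> texture B (unitary_channel U \<rho>)"
    if "U \<in> free_unitaries Ops" for U
  proof (rule field_le_epsilon)
    fix e :: real
    assume "e > 0"
    define f where "f = unitary_channel U"
    have U: "unitary U" "f \<in> Ops"
      using that by (auto simp: free_unitaries_def f_def)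
    have orbit: "pure_state ((f ^^ k) \<sigma>) \<and> (f ^^ k) \<sigma> \<in> F" for k
      by (induction k)
        (use \<sigma> free U in \<open>auto simp: f_def intro: pure_state_unitary_channel\<close>)
    \<comment> \<open>\<open>f\<close> applied to the \<open>k\<close>-th iterate nearly returns to
      \<open>\<sigma>\<close>, so that iterate is a free substitute for the preimage of
      \<open>\<sigma>\<close> under \<open>f\<close>.\<close>
    obtain k where k: "dist ((f ^^ Suc k) \<sigma>) \<sigma> < e"
    proof (rule isometry_recurrence[of "sphere 0 1" f \<sigma> e])
      show "(f ^^ k) \<sigma> \<in> sphere 0 1" for k
        using orbit norm_pure_state by auto
    qed (use \<open>e > 0\<close> U in \<open>auto simp: f_def dist_unitary_channel\<close>)
    define \<phi> where "\<phi> = (f ^^ k) \<sigma>"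
    have \<phi>: "pure_state \<phi>" "\<phi> \<in> F"
      using orbit by (auto simp: \<phi>_def)
    have "norm (f \<rho>) = 1"
      using U \<rho> by (auto simp: f_def intro!: norm_pure_state pure_state_unitary_channel)
    then have "(\<sigma> - f \<phi>) \<bullet> f \<rho> \<le> e"
      using norm_cauchy_schwarz[of "\<sigma> - f \<phi>" "f \<rho>"] k
      by (simp add: \<phi>_def dist_norm norm_minus_commute)
    \<comment> \<open>\<open>f\<close> preserves inner products, so it drops out of
      \<open>f \<phi> \<bullet> f \<rho>\<close>.\<close>
    then have "\<sigma> \<bullet> f \<rho> \<le> \<phi> \<bullet> \<rho> + e"
      using U by (simp add: f_def inner_diff_left inner_unitary_channel)
    also have "\<phi> \<bullet> \<rho> \<le> \<Lambda> \<phi> \<bullet> \<Lambda> \<rho>"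
      using pure_preserving_inner_mono[OF lin _ \<phi>(1) \<rho>(1)] pure by blast
    finally have le: "\<sigma> \<bullet> f \<rho> \<le> \<Lambda> \<phi> \<bullet> \<Lambda> \<rho> + e"
      by simp
    \<comment> \<open>\<open>\<Lambda> \<phi>\<close> is both free and pure, so the connecting
      assumption applies. \<open>V\<close> may depend on \<open>e\<close>, which the infimum
      tolerates.\<close>
    obtain V where V: "V \<in> free_unitaries Ops" "unitary_channel V (\<Lambda> \<phi>) = \<sigma>"
      using assms(5)[of "\<Lambda> \<phi>" \<sigma>] free[OF \<phi>(2) \<Lambda>] pure \<phi>(1) \<sigma> by blast
    have "\<Lambda> \<phi> \<bullet> \<Lambda> \<rho> = \<sigma> \<bullet> unitary_channel V (\<Lambda> \<rho>)"
      using V inner_unitary_channel[of V "\<Lambda> \<phi>" "\<Lambda> \<rho>"] by (simp add: free_unitaries_def)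
    then have "texture B (unitary_channel V (\<Lambda> \<rho>)) \<le> texture B (unitary_channel U \<rho>) + e"
      using le by (simp add: texture_inner \<sigma>_def f_def)
    moreover have "texture_monotone Ops B (\<Lambda> \<rho>) \<le> texture B (unitary_channel V (\<Lambda> \<rho>))"
      unfolding texture_monotone_def using cINF_lower[OF bdd V(1)] .
    ultimately show "texture_monotone Ops B (\<Lambda> \<rho>) \<le> texture B (unitary_channel U \<rho>) + e"
      by simp
  qed
  then show "texture_monotone Ops B (\<Lambda> (proj \<psi>)) \<le> texture_monotone Ops B (proj \<psi>)"
    unfolding \<rho>_def[symmetric] texture_monotone_def[of _ _ \<rho>]
    by (intro cINF_greatest assms(4))
qed

end
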